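(* Let $1<p<q<\infty$. Then the ideal $\mathcal J^{\mathrm{FSS}}$ of all finitely strictly singular operators in $L(\ell_p,\ell_q)$ is proper, i.e. $\mathcal J^{\mathrm{FSS}}\ne L(\ell_p,\ell_q)$.
   Context: $L(X,Y)$ is the space of bounded linear operators from $X$ to $Y$. An operator $S\colon X\to Y$ is finitely strictly singular (FSS) if for every $\varepsilon>0$ there is $n\in\mathbb N$ such that $\inf_{x\in E,\|x\|=1}\|Sx\|<\varepsilon$ for every $n$-dimensional subspace $E$ of $X$. *)

theory Defs
  imports Complex_Main "HOL-Library.FuncSet" "HOL-Library.Function_Algebras"
begin

text \<open>
  Addition and zero of sequences are the pointwise ones of \<open>HOL-Library.Function_Algebras\<close>.
  The scalar type \<open>'k\<close> is meant to be \<open>real\<close> or \<open>complex\<close>.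
\<close>

definition seq_scale :: "'k::field \<Rightarrow> (nat \<Rightarrow> 'k) \<Rightarrow> (nat \<Rightarrow> 'k)" where
  "seq_scale c x = (\<lambda>n. c * x n)"

interpretation seq: vector_space "seq_scale :: 'k::field \<Rightarrow> _"
  by unfold_locales (auto simp: seq_scale_def fun_eq_iff algebra_simps)

definition ell :: "real \<Rightarrow> (nat \<Rightarrow> 'k::real_normed_field) set" where
  "ell p = {x. summable (\<lambda>n. norm (x n) powr p)}"

definition ell_norm :: "real \<Rightarrow> (nat \<Rightarrow> 'k::real_normed_field) \<Rightarrow> real" where
  "ell_norm p x = (\<Sum>n. norm (x n) powr p) powr (1 / p)"

text \<open>
  The space \<open>L(\<ell>\<^sub>p, \<ell>\<^sub>q)\<close>.  Using the extensional function space makes two operators equal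
  as soon as they agree on \<open>\<ell>\<^sub>p\<close>.
\<close>

definition ell_ops ::
  "real \<Rightarrow> real \<Rightarrow> ((nat \<Rightarrow> 'k::real_normed_field) \<Rightarrow> (nat \<Rightarrow> 'k)) set" where
  "ell_ops p q = {S \<in> ell p \<rightarrow>\<^sub>E ell q.
     (\<forall>x\<in>ell p. \<forall>y\<in>ell p. S (x + y) = S x + S y) \<and>
     (\<forall>c. \<forall>x\<in>ell p. S (seq_scale c x) = seq_scale c (S x)) \<and>
     (\<exists>C. \<forall>x\<in>ell p. ell_norm q (S x) \<le> C * ell_norm p x)}"

text \<open>
  The dimension \<open>n\<close> is positive: the zero subspace has no unit vector, so its infimum would be
  \<open>\<infinity>\<close>.  It also excludes infinite-dimensional \<open>E\<close>, to which \<open>seq.dim\<close> assigns \<open>0\<close>.  For the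
  remaining \<open>E\<close> the infimum is over a nonempty set of nonnegative reals.
\<close>

definition finitely_strictly_singular ::
  "real \<Rightarrow> real \<Rightarrow> ((nat \<Rightarrow> 'k::real_normed_field) \<Rightarrow> (nat \<Rightarrow> 'k)) \<Rightarrow> bool" where
  "finitely_strictly_singular p q S \<longleftrightarrow>
     (\<forall>\<epsilon>>0. \<exists>n>0. \<forall>E. E \<subseteq> ell p \<and> seq.subspace E \<and> seq.dim E = n \<longrightarrow>
        (INF x\<in>{x \<in> E. ell_norm p x = 1}. ell_norm q (S x)) < \<epsilon>)"

definition FSS_ideal ::
  "real \<Rightarrow> real \<Rightarrow> ((nat \<Rightarrow> 'k::real_normed_field) \<Rightarrow> (nat \<Rightarrow> 'k)) set" where
  "FSS_ideal p q = {S \<in> ell_ops p q. finitely_strictly_singular p q S}"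

end

theory Submission
  imports Defs "HOL-Analysis.Convex" "HOL-Library.Nat_Bijection"
begin

text \<open>
  For \<open>1 < p < \<infinity>\<close> the space \<open>\<ell>\<^sub>p\<close> contains uniformly complemented copies of the Euclidean spaces
  \<open>\<ell>\<^sub>2\<^sup>n\<close>, and an operator that moves these copies in \<open>\<ell>\<^sub>p\<close> to such copies in \<open>\<ell>\<^sub>q\<close> is not finitely
  strictly singular. The copies are spanned by Rademacher functions.

  On the cube \<open>\<Omega>\<^sub>n = {-1, 1}\<^sup>n\<close> with normalized counting measure let \<open>r\<^sub>1, \<dots>, r\<^sub>n\<close> be the coordinate
  functions and let \<open>P f = \<Sum>\<^sub>i E(f r\<^sub>i) r\<^sub>i\<close> be the orthogonal projection onto their span. The proof
  rests on two facts.

  \<^item> The norm of \<open>P\<close> from \<open>L\<^sub>p(\<Omega>\<^sub>n)\<close> to \<open>L\<^sub>q(\<Omega>\<^sub>n)\<close> is bounded independently of \<open>n\<close>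
    (\<open>rademacher_proj_bound_real\<close>, \<open>rademacher_proj_bound_complex\<close>). By the upper half of
    Khintchine's inequality (\<open>Khintchine_upper\<close>) every \<open>L\<^sub>s\<close> norm of \<open>P f\<close> is at most a constant
    times the \<open>\<ell>\<^sub>2\<close> norm of its coefficients, and by duality with the exponent conjugate to \<open>p\<close> that
    \<open>\<ell>\<^sub>2\<close> norm is at most a constant times the \<open>L\<^sub>p\<close> norm of \<open>f\<close>
    (\<open>rademacher_coeff_l2_bound\<close>). The duality step is where \<open>p > 1\<close> enters.

  \<^item> \<open>P\<close> fixes the span of the \<open>r\<^sub>i\<close>, and on a probability space the \<open>L\<^sub>p\<close> norm is at most the
    \<open>L\<^sub>q\<close> norm. So \<open>P\<close>, as a map from \<open>L\<^sub>p\<close> to \<open>L\<^sub>q\<close>, does not decrease norms on this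
    \<open>n\<close>-dimensional space. This replaces the lower half of Khintchine's inequality.

  Up to a scalar, \<open>L\<^sub>p(\<Omega>\<^sub>n)\<close> is \<open>\<ell>\<^sub>p\<close> on \<open>2\<^sup>n\<close> points. The disjoint union of all these cubes embeds
  in \<open>\<nat>\<close>, and the block diagonal operator with the rescaled projections as its blocks
  (\<open>block_op\<close>) is bounded from \<open>\<ell>\<^sub>p\<close> to \<open>\<ell>\<^sub>q\<close> because \<open>p \<le> q\<close> makes the \<open>\<ell>\<^sub>q\<close> norm of the sequence
  of block norms at most its \<open>\<ell>\<^sub>p\<close> norm. For every \<open>n\<close> it is bounded below by \<open>1\<close> on the unit sphere
  of an \<open>n\<close>-dimensional space, so it fails the defining condition already for \<open>\<epsilon> = 1\<close>.
\<close>

section \<open>Elementary inequalities\<close>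

lemma Holder_inequality_sum:
  fixes f g :: "'a \<Rightarrow> real"
  assumes I: "finite I" and p: "p > 1" and r: "r > 1" "1 / p + 1 / r = 1"
    and f: "\<And>i. i \<in> I \<Longrightarrow> f i \<ge> 0" and g: "\<And>i. i \<in> I \<Longrightarrow> g i \<ge> 0"
  shows "(\<Sum>i\<in>I. f i * g i) \<le> (\<Sum>i\<in>I. f i powr p) powr (1 / p) * (\<Sum>i\<in>I. g i powr r) powr (1 / r)"
proof -
  define F where "F = (\<Sum>i\<in>I. f i powr p)"
  define G where "G = (\<Sum>i\<in>I. g i powr r)"
  have F0: "F \<ge> 0" and G0: "G \<ge> 0" unfolding F_def G_def by (auto intro: sum_nonneg)
  show ?thesis
  proof (cases "F = 0 \<or> G = 0")
    case True
    then have "\<forall>i\<in>I. f i * g i = 0"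
    proof
      assume "F = 0"
      then have "\<forall>i\<in>I. f i powr p = 0"
        unfolding F_def by (subst (asm) sum_nonneg_eq_0_iff[OF I]) auto
      then show ?thesis by simp
    next
      assume "G = 0"
      then have "\<forall>i\<in>I. g i powr r = 0"
        unfolding G_def by (subst (asm) sum_nonneg_eq_0_iff[OF I]) auto
      then show ?thesis by simp
    qed
    then have "(\<Sum>i\<in>I. f i * g i) = 0" by (intro sum.neutral) auto
    then show ?thesis by simp
  next
    case False
    then have FG: "F > 0" "G > 0" using F0 G0 by auto
    define a where "a = F powr (1 / p)"
    define b where "b = G powr (1 / r)"
    have ab: "a > 0" "b > 0" using FG by (auto simp: a_def b_def)
    have ap: "a powr p = F" and br: "b powr r = G"
      using FG p r by (auto simp: a_def b_def powr_powr)
    have "(\<Sum>i\<in>I. (f i / a) * (g i / b)) \<le> (\<Sum>i\<in>I. (f i / a) powr p / p + (g i / b) powr r / r)"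
      using ab p r f g by (intro sum_mono Youngs_inequality) auto
    also have "\<dots> = (\<Sum>i\<in>I. f i powr p / (p * F)) + (\<Sum>i\<in>I. g i powr r / (r * G))"
      using ab f g by (simp add: sum.distrib powr_divide ap br mult.commute)
    also have "\<dots> = F / (p * F) + G / (r * G)"
      by (simp only: F_def G_def sum_divide_distrib)
    also have "\<dots> = 1" using FG r by simp
    finally have "(\<Sum>i\<in>I. f i * g i / (a * b)) \<le> 1" by simp
    then have "(\<Sum>i\<in>I. f i * g i) / (a * b) \<le> 1" by (simp only: sum_divide_distrib)
    then show ?thesis using ab by (simp add: a_def b_def F_def G_def field_simps)
  qed
qed

text \<open>
  The constant in the exponent could be halved, but the crude version follows from the quadratic
  bound on \<open>exp\<close> in \<open>[0, 1]\<close>; any constant gives a Khintchine inequality.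
\<close>
lemma exp_plus_exp_minus_le:
  fixes x :: real
  shows "exp x + exp (- x) \<le> 2 * exp (x\<^sup>2)"
proof -
  have *: "exp y + exp (- y) \<le> 2 * exp (y\<^sup>2)" if y: "y \<ge> 0" for y :: real
  proof (cases "y \<le> 1")
    case True
    have 1: "exp y \<le> 1 + y + y\<^sup>2" using True y by (simp add: exp_bound)
    have "(1 - y + y\<^sup>2) * (1 + y) = 1 + y ^ 3" by algebra
    then have "1 \<le> (1 - y + y\<^sup>2) * (1 + y)" using y by simp
    also have "\<dots> \<le> (1 - y + y\<^sup>2) * exp y"
      using True y by (intro mult_left_mono) (auto simp: exp_ge_add_one_self)
    finally have 2: "exp (- y) \<le> 1 - y + y\<^sup>2" by (simp add: exp_minus field_simps)
    have "1 + y\<^sup>2 \<le> exp (y\<^sup>2)" by (rule exp_ge_add_one_self)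
    with 1 2 show ?thesis by linarith
  next
    case False
    then have "y \<le> y\<^sup>2" by (simp add: power2_eq_square)
    then have "exp y \<le> exp (y\<^sup>2)" "exp (- y) \<le> exp (y\<^sup>2)" using y by auto
    then show ?thesis by linarith
  qed
  show ?thesis using *[of x] *[of "- x"] by (cases "x \<ge> 0") auto
qed

text \<open>
  This turns exponential moments into moments of order \<open>s\<close>. It is \<open>t / s \<le> exp (t / s)\<close>, raised to
  the power \<open>s\<close>.
\<close>
lemma powr_le_powr_exp:
  fixes t s :: real
  assumes "t \<ge> 0" "s > 0"
  shows "t powr s \<le> s powr s * exp t"
proof -
  have "t / s \<le> exp (t / s)" using exp_ge_add_one_self[of "t / s"] by linarith
  then have "(t / s) powr s \<le> exp (t / s) powr s" using assms by (intro powr_mono2) auto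
  then show ?thesis using assms by (simp add: powr_divide exp_powr_real field_simps)
qed

lemma add_powr_le:
  fixes a b s :: real
  assumes "a \<ge> 0" "b \<ge> 0" "s \<ge> 0"
  shows "(a + b) powr s \<le> 2 powr s * (a powr s + b powr s)"
proof -
  have "(a + b) powr s \<le> (2 * max a b) powr s" using assms by (intro powr_mono2) auto
  also have "\<dots> = 2 powr s * max a b powr s" using assms by (simp add: powr_mult)
  also have "\<dots> \<le> 2 powr s * (a powr s + b powr s)" by (auto simp: max_def)
  finally show ?thesis .
qed

text \<open>
  Each factor \<open>b i powr (s - 1)\<close> is at most the same power of the whole sum. In the form
  \<open>s = q / p\<close> this compares the \<open>\<ell>\<^sub>q\<close> sum of the blocks with their \<open>\<ell>\<^sub>p\<close> sum.
\<close>
lemma sum_powr_le_powr_sum: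
  fixes b :: "'a \<Rightarrow> real"
  assumes "finite I" "\<And>i. i \<in> I \<Longrightarrow> b i \<ge> 0" "s \<ge> 1"
  shows "(\<Sum>i\<in>I. b i powr s) \<le> (\<Sum>i\<in>I. b i) powr s"
proof -
  define B where "B = (\<Sum>i\<in>I. b i)"
  have B: "B \<ge> 0" unfolding B_def using assms by (intro sum_nonneg)
  have split: "t powr s = t * t powr (s - 1)" if "t \<ge> 0" for t :: real
    using powr_mult_base[OF that, of "s - 1"] by simp
  have "b i powr s \<le> b i * B powr (s - 1)" if "i \<in> I" for i
  proof -
    have "b i \<le> B" unfolding B_def using assms that by (intro member_le_sum) auto
    then have "b i powr (s - 1) \<le> B powr (s - 1)" using assms that by (intro powr_mono2) auto
    then show ?thesis using assms(2)[OF that] by (subst split) (auto intro: mult_left_mono)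
  qed
  then have "(\<Sum>i\<in>I. b i powr s) \<le> (\<Sum>i\<in>I. b i * B powr (s - 1))" by (rule sum_mono)
  also have "\<dots> = B powr s" using split[OF B] by (simp add: B_def sum_distrib_right)
  finally show ?thesis by (simp add: B_def)
qed

section \<open>Khintchine's inequality\<close>

text \<open>
  A point of the cube \<open>{-1, 1}\<^sup>n\<close> is represented by the set of its coordinates equal to \<open>1\<close>, a
  subset of \<open>{..<n}\<close>; \<open>rademacher i\<close> is the \<open>i\<close>-th coordinate function.
\<close>
definition rademacher :: "nat \<Rightarrow> nat set \<Rightarrow> real" where
  "rademacher i A = (if i \<in> A then 1 else - 1)"

text \<open>
  Independence of the Rademacher functions: the exponential moment of a linear combination is the
  product of the exponential moments of its terms.
\<close>
lemma sum_Pow_exp_rademacher: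
  assumes "finite I"
  shows "(\<Sum>A\<in>Pow I. exp (\<Sum>i\<in>I. a i * rademacher i A)) = (\<Prod>i\<in>I. exp (a i) + exp (- a i))"
  using assms
proof (induction I)
  case (insert k I)
  have disj: "Pow I \<inter> insert k ` Pow I = {}" using insert by auto
  have inj: "inj_on (insert k) (Pow I)" using insert by (auto simp: inj_on_def)
  have 1: "(\<Sum>i\<in>insert k I. a i * rademacher i A) = - a k + (\<Sum>i\<in>I. a i * rademacher i A)" 
    if "A \<in> Pow I" for A
    using insert that by (auto simp: rademacher_def)
  have 2: "(\<Sum>i\<in>insert k I. a i * rademacher i (insert k A)) = a k + (\<Sum>i\<in>I. a i * rademacher i A)" 
    if "A \<in> Pow I" for A
  proof -
    have "(\<Sum>i\<in>I. a i * rademacher i (insert k A)) = (\<Sum>i\<in>I. a i * rademacher i A)"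
      using insert by (intro sum.cong) (auto simp: rademacher_def)
    then show ?thesis using insert by (simp add: rademacher_def)
  qed
  have "(\<Sum>A\<in>Pow (insert k I). exp (\<Sum>i\<in>insert k I. a i * rademacher i A)) =
     (\<Sum>A\<in>Pow I. exp (\<Sum>i\<in>insert k I. a i * rademacher i A)) +
     (\<Sum>A\<in>Pow I. exp (\<Sum>i\<in>insert k I. a i * rademacher i (insert k A)))"
    using insert disj by (simp add: Pow_insert sum.union_disjoint sum.reindex[OF inj] o_def)
  also have "\<dots> = (exp (a k) + exp (- a k)) * (\<Sum>A\<in>Pow I. exp (\<Sum>i\<in>I. a i * rademacher i A))"
    unfolding sum_distrib_left distrib_right sum.distrib[symmetric]
    by (intro sum.cong refl) (simp add: 1 2 exp_add exp_diff exp_minus divide_inverse distrib_right del: sum.insert)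
  finally show ?case using insert by simp
qed auto

lemma sum_Pow_exp_rademacher_le:
  "(\<Sum>A\<in>Pow {..<n}. exp (\<Sum>i<n. a i * rademacher i A)) \<le> 2 ^ n * exp (\<Sum>i<n. (a i)\<^sup>2)"
proof -
  have "(\<Sum>A\<in>Pow {..<n}. exp (\<Sum>i<n. a i * rademacher i A)) = (\<Prod>i<n. exp (a i) + exp (- a i))"
    by (rule sum_Pow_exp_rademacher) simp
  also have "\<dots> \<le> (\<Prod>i<n. 2 * exp ((a i)\<^sup>2))"
    by (intro prod_mono) (auto simp: exp_plus_exp_minus_le intro: add_nonneg_nonneg)
  also have "\<dots> = 2 ^ n * exp (\<Sum>i<n. (a i)\<^sup>2)" by (simp add: prod.distrib exp_sum)
  finally show ?thesis .
qed

text \<open>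
  Both \<open>S = \<Sum>\<^sub>i a\<^sub>i r\<^sub>i\<close> and \<open>-S\<close> have exponential moment at most \<open>exp 1\<close>, and
  \<open>\<bar>S\<bar>\<^sup>s\<close> is dominated by a multiple of \<open>exp S + exp (- S)\<close>.
\<close>
lemma Khintchine_upper_normalized:
  assumes "s > 0" and a: "(\<Sum>i<n. (a i)\<^sup>2) = 1"
  shows "(\<Sum>A\<in>Pow {..<n}. \<bar>\<Sum>i<n. a i * rademacher i A\<bar> powr s) \<le> 2 * s powr s * exp 1 * 2 ^ n"
proof -
  define S where "S A = (\<Sum>i<n. a i * rademacher i A)" for A
  have "\<bar>S A\<bar> powr s \<le> s powr s * (exp (S A) + exp (- S A))" for A
  proof -
    have "\<bar>S A\<bar> powr s \<le> s powr s * exp \<bar>S A\<bar>" using assms by (intro powr_le_powr_exp) auto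
    also have "\<dots> \<le> s powr s * (exp (S A) + exp (- S A))"
      by (intro mult_left_mono) (auto simp: abs_if)
    finally show ?thesis .
  qed
  then have "(\<Sum>A\<in>Pow {..<n}. \<bar>S A\<bar> powr s) \<le> (\<Sum>A\<in>Pow {..<n}. s powr s * (exp (S A) + exp (- S A)))"
    by (intro sum_mono)
  also have "\<dots> = s powr s * ((\<Sum>A\<in>Pow {..<n}. exp (S A)) + (\<Sum>A\<in>Pow {..<n}. exp (- S A)))"
    by (simp add: sum_distrib_left[symmetric] sum.distrib)
  also have "\<dots> \<le> s powr s * (2 ^ n * exp 1 + 2 ^ n * exp 1)"
    using sum_Pow_exp_rademacher_le[of a n] sum_Pow_exp_rademacher_le[of "\<lambda>i. - a i" n]
    by (intro mult_left_mono add_mono) (auto simp: S_def a sum_negf)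
  finally show ?thesis by (simp add: S_def mult_ac)
qed

lemma Khintchine_upper:
  assumes "s > 0"
  shows "(\<Sum>A\<in>Pow {..<n}. \<bar>\<Sum>i<n. a i * rademacher i A\<bar> powr s)
    \<le> 2 * s powr s * exp 1 * 2 ^ n * (sqrt (\<Sum>i<n. (a i)\<^sup>2)) powr s"
proof -
  define l where "l = sqrt (\<Sum>i<n. (a i)\<^sup>2)"
  have l: "l \<ge> 0" "l\<^sup>2 = (\<Sum>i<n. (a i)\<^sup>2)" by (simp_all add: l_def sum_nonneg)
  show ?thesis
  proof (cases "l = 0")
    case True
    then have "(\<Sum>i<n. (a i)\<^sup>2) = 0" using l by simp
    then have "\<forall>i\<in>{..<n}. (a i)\<^sup>2 = 0" by (subst (asm) sum_nonneg_eq_0_iff) auto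
    then have "(\<Sum>i<n. a i * rademacher i A) = 0" for A by (intro sum.neutral) auto
    then show ?thesis using assms by simp
  next
    case False
    then have "l > 0" using l by simp
    define b where "b i = a i / l" for i
    have ab: "(\<Sum>i<n. a i * rademacher i A) = l * (\<Sum>i<n. b i * rademacher i A)" for A
      using \<open>l > 0\<close> by (simp add: b_def sum_distrib_left)
    have "(\<Sum>i<n. (b i)\<^sup>2) = 1"
      using \<open>l > 0\<close> by (simp add: b_def power_divide sum_divide_distrib[symmetric] l(2)[symmetric])
    from Khintchine_upper_normalized[OF assms this]
    have "l powr s * (\<Sum>A\<in>Pow {..<n}. \<bar>\<Sum>i<n. b i * rademacher i A\<bar> powr s) \<le>
       l powr s * (2 * s powr s * exp 1 * 2 ^ n)" by (intro mult_left_mono) auto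
    moreover have "(\<Sum>A\<in>Pow {..<n}. \<bar>\<Sum>i<n. a i * rademacher i A\<bar> powr s) =
        l powr s * (\<Sum>A\<in>Pow {..<n}. \<bar>\<Sum>i<n. b i * rademacher i A\<bar> powr s)"
      unfolding ab sum_distrib_left[of "l powr s"] using \<open>l > 0\<close> by (simp add: abs_mult powr_mult)
    ultimately show ?thesis
      unfolding l_def[symmetric] by (simp only: mult_ac)
  qed
qed

section \<open>The Rademacher projection\<close>

definition rademacher_coeff :: "nat \<Rightarrow> (nat set \<Rightarrow> 'k::real_normed_field) \<Rightarrow> nat \<Rightarrow> 'k" where
  "rademacher_coeff n f i = (\<Sum>A\<in>Pow {..<n}. rademacher i A *\<^sub>R f A) /\<^sub>R 2 ^ n"

definition rademacher_proj :: "nat \<Rightarrow> (nat set \<Rightarrow> 'k::real_normed_field) \<Rightarrow> nat set \<Rightarrow> 'k" where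
  "rademacher_proj n f A = (\<Sum>i<n. rademacher i A *\<^sub>R rademacher_coeff n f i)"

text \<open>
  In terms of the normalized counting measure on the cube, the projection has norm at most
  \<open>C powr (1 / q)\<close> from \<open>L\<^sub>p\<close> to \<open>L\<^sub>q\<close>, for every dimension \<open>n\<close>.
\<close>
definition rademacher_proj_bound :: "'k::real_normed_field itself \<Rightarrow> real \<Rightarrow> real \<Rightarrow> real \<Rightarrow> bool" where
  "rademacher_proj_bound _ p q C \<longleftrightarrow> (\<forall>n (f :: nat set \<Rightarrow> 'k).
     (\<Sum>A\<in>Pow {..<n}. norm (rademacher_proj n f A) powr q) \<le>
       C * 2 ^ n * ((\<Sum>A\<in>Pow {..<n}. norm (f A) powr p) / 2 ^ n) powr (q / p))"

text \<open>
  The square of the \<open>\<ell>\<^sub>2\<close> norm \<open>l\<close> of the coefficients is the scalar product of \<open>f\<close> with its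
  projection \<open>y\<close>. Hoelder's inequality bounds it by the \<open>L\<^sub>p\<close> norm of \<open>f\<close> times the \<open>L\<^sub>r\<close> norm of
  \<open>y\<close>, which is at most a constant times \<open>l\<close> by Khintchine's inequality; then one factor \<open>l\<close> cancels.
\<close>
lemma rademacher_coeff_l2_bound:
  fixes f :: "nat set \<Rightarrow> real"
  assumes p: "p > 1" and r: "r > 1" "1 / p + 1 / r = 1"
  shows "sqrt (\<Sum>i<n. (rademacher_coeff n f i)\<^sup>2)
    \<le> (2 * r powr r * exp 1) powr (1 / r) * ((\<Sum>A\<in>Pow {..<n}. \<bar>f A\<bar> powr p) / 2 ^ n) powr (1 / p)"
proof -
  define c where "c = rademacher_coeff n f"
  define l where "l = sqrt (\<Sum>i<n. (c i)\<^sup>2)"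
  define y where "y A = (\<Sum>i<n. c i * rademacher i A)" for A
  define K where "K = 2 * r powr r * exp 1"
  define F where "F = (\<Sum>A\<in>Pow {..<n}. \<bar>f A\<bar> powr p)"
  have l: "l \<ge> 0" "l\<^sup>2 = (\<Sum>i<n. (c i)\<^sup>2)" by (simp_all add: l_def sum_nonneg)
  have K: "K > 0" using r by (simp add: K_def)
  have F: "F \<ge> 0" unfolding F_def by (intro sum_nonneg) auto
  have "2 ^ n * l\<^sup>2 = (\<Sum>i<n. c i * (2 ^ n * c i))"
    unfolding l(2) by (simp add: sum_distrib_left power2_eq_square mult_ac)
  also have "\<dots> = (\<Sum>i<n. \<Sum>A\<in>Pow {..<n}. f A * (c i * rademacher i A))"
    unfolding c_def by (subst (2) rademacher_coeff_def) (simp add: sum_distrib_left mult_ac)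
  also have "\<dots> = (\<Sum>A\<in>Pow {..<n}. f A * y A)"
    by (subst sum.swap) (simp add: y_def sum_distrib_left)
  also have "\<dots> \<le> (\<Sum>A\<in>Pow {..<n}. \<bar>f A\<bar> * \<bar>y A\<bar>)"
    by (intro sum_mono) (metis abs_ge_self abs_mult)
  also have "\<dots> \<le> F powr (1 / p) * (\<Sum>A\<in>Pow {..<n}. \<bar>y A\<bar> powr r) powr (1 / r)"
    unfolding F_def using p r by (intro Holder_inequality_sum) auto
  also have "\<dots> \<le> F powr (1 / p) * (K * 2 ^ n * l powr r) powr (1 / r)"
    using Khintchine_upper[of r c n] r
    by (intro mult_left_mono powr_mono2) (auto simp: K_def l_def y_def intro: sum_nonneg)
  also have "\<dots> = F powr (1 / p) * (K powr (1 / r) * (2 ^ n) powr (1 / r) * l)"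
    using K l r by (simp add: powr_mult powr_powr)
  also have "((2::real) ^ n) powr (1 / r) = 2 ^ n / (2 ^ n) powr (1 / p)"
  proof -
    have "1 / r = 1 - 1 / p" using r by simp
    then show ?thesis by (simp add: powr_diff del: powr_power)
  qed
  also have "F powr (1 / p) * (K powr (1 / r) * (2 ^ n / (2 ^ n) powr (1 / p)) * l)
     = 2 ^ n * (K powr (1 / r) * (F / 2 ^ n) powr (1 / p) * l)"
    using F by (simp add: powr_divide field_simps)
  finally have "l\<^sup>2 \<le> K powr (1 / r) * (F / 2 ^ n) powr (1 / p) * l" by simp
  then have "l \<le> K powr (1 / r) * (F / 2 ^ n) powr (1 / p)"
    using l(1) by (cases "l = 0") (auto simp: power2_eq_square)
  then show ?thesis by (simp add: l_def c_def K_def F_def)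
qed

lemma rademacher_proj_bound_real:
  assumes p: "p > 1" and q: "q > 0"
  shows "\<exists>C\<ge>0. rademacher_proj_bound TYPE(real) p q C"
proof -
  define r where "r = p / (p - 1)"
  have r: "r > 1" "1 / p + 1 / r = 1" using p by (auto simp: r_def field_simps)
  define K where "K = (2 * r powr r * exp 1) powr (1 / r)"
  define M where "M = 2 * q powr q * exp 1"
  have KM: "K \<ge> 0" "M \<ge> 0" by (simp_all add: K_def M_def)
  have "(\<Sum>A\<in>Pow {..<n}. norm (rademacher_proj n f A) powr q) \<le>
       M * K powr q * 2 ^ n * ((\<Sum>A\<in>Pow {..<n}. norm (f A) powr p) / 2 ^ n) powr (q / p)"
    for n and f :: "nat set \<Rightarrow> real"
  proof -
    define F where "F = (\<Sum>A\<in>Pow {..<n}. \<bar>f A\<bar> powr p) / 2 ^ n"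
    define l where "l = sqrt (\<Sum>i<n. (rademacher_coeff n f i)\<^sup>2)"
    have F: "F \<ge> 0" unfolding F_def by (intro divide_nonneg_nonneg sum_nonneg) auto
    have l: "l \<ge> 0" by (simp add: l_def sum_nonneg)
    have "(\<Sum>A\<in>Pow {..<n}. norm (rademacher_proj n f A) powr q) \<le> M * 2 ^ n * l powr q"
      using Khintchine_upper[of q "rademacher_coeff n f" n] q
      by (simp add: rademacher_proj_def M_def l_def mult.commute)
    also have "\<dots> \<le> M * 2 ^ n * (K * F powr (1 / p)) powr q"
      using rademacher_coeff_l2_bound[OF p r, of n f] l q KM
      by (intro mult_left_mono powr_mono2) (auto simp: l_def K_def F_def)
    also have "\<dots> = M * K powr q * 2 ^ n * F powr (q / p)"
      using KM F by (simp add: powr_mult powr_powr)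
    finally show ?thesis by (simp add: F_def)
  qed
  then show ?thesis unfolding rademacher_proj_bound_def using KM
    by (intro exI[of _ "M * K powr q"]) auto
qed

lemma Re_rademacher_proj: "Re (rademacher_proj n f A) = rademacher_proj n (\<lambda>B. Re (f B)) A"
  by (simp add: rademacher_proj_def rademacher_coeff_def mult.assoc)

lemma Im_rademacher_proj: "Im (rademacher_proj n f A) = rademacher_proj n (\<lambda>B. Im (f B)) A"
  by (simp add: rademacher_proj_def rademacher_coeff_def mult.assoc)

text \<open>
  The projection has a real kernel, so it acts separately on real and imaginary parts.
\<close>
lemma rademacher_proj_bound_complex:
  assumes p: "p > 1" and q: "q > 0"
  shows "\<exists>C\<ge>0. rademacher_proj_bound TYPE(complex) p q C"
proof -
  obtain C where C: "C \<ge> 0" and bd: "rademacher_proj_bound TYPE(real) p q C"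
    using rademacher_proj_bound_real[OF assms] by blast
  have "(\<Sum>A\<in>Pow {..<n}. norm (rademacher_proj n f A) powr q) \<le>
       (2 powr q * (2 * C)) * 2 ^ n * ((\<Sum>A\<in>Pow {..<n}. norm (f A) powr p) / 2 ^ n) powr (q / p)"
    for n and f :: "nat set \<Rightarrow> complex"
  proof -
    define F where "F = (\<Sum>A\<in>Pow {..<n}. norm (f A) powr p) / 2 ^ n"
    have part: "(\<Sum>A\<in>Pow {..<n}. \<bar>rademacher_proj n g A\<bar> powr q) \<le> C * 2 ^ n * F powr (q / p)"
      if g: "\<And>A. \<bar>g A\<bar> \<le> norm (f A)" for g :: "nat set \<Rightarrow> real"
    proof -
      have nn: "0 \<le> (\<Sum>A\<in>Pow {..<n}. norm (g A) powr p) / 2 ^ n"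
        by (intro divide_nonneg_nonneg sum_nonneg) auto
      have "(\<Sum>A\<in>Pow {..<n}. \<bar>rademacher_proj n g A\<bar> powr q) \<le>
          C * 2 ^ n * ((\<Sum>A\<in>Pow {..<n}. norm (g A) powr p) / 2 ^ n) powr (q / p)"
        using bd by (simp add: rademacher_proj_bound_def)
      also have "\<dots> \<le> C * 2 ^ n * F powr (q / p)"
        unfolding F_def using C p q g
        by (intro mult_left_mono powr_mono2 divide_right_mono sum_mono) (use nn in auto)
      finally show ?thesis .
    qed
    have "norm (rademacher_proj n f A) powr q \<le>
        2 powr q * (\<bar>Re (rademacher_proj n f A)\<bar> powr q + \<bar>Im (rademacher_proj n f A)\<bar> powr q)" for A
      using powr_mono2[OF _ _ cmod_le, of q "rademacher_proj n f A"] q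
      by (intro order_trans[OF _ add_powr_le]) auto
    then have "(\<Sum>A\<in>Pow {..<n}. norm (rademacher_proj n f A) powr q) \<le>
        2 powr q * ((\<Sum>A\<in>Pow {..<n}. \<bar>Re (rademacher_proj n f A)\<bar> powr q) +
                    (\<Sum>A\<in>Pow {..<n}. \<bar>Im (rademacher_proj n f A)\<bar> powr q))"
      unfolding sum.distrib[symmetric] sum_distrib_left by (intro sum_mono)
    also have "\<dots> \<le> 2 powr q * (C * 2 ^ n * F powr (q / p) + C * 2 ^ n * F powr (q / p))"
      unfolding Re_rademacher_proj Im_rademacher_proj
      by (intro mult_left_mono add_mono part) (auto simp: abs_Re_le_cmod abs_Im_le_cmod)
    finally show ?thesis by (simp add: F_def algebra_simps)
  qed
  then show ?thesis unfolding rademacher_proj_bound_def using C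
    by (intro exI[of _ "2 powr q * (2 * C)"]) auto
qed

lemma rademacher_coeff_add:
  "rademacher_coeff n (\<lambda>A. f A + g A) i = rademacher_coeff n f i + rademacher_coeff n g i"
  by (simp add: rademacher_coeff_def scaleR_add_right sum.distrib)

lemma rademacher_proj_add:
  "rademacher_proj n (\<lambda>A. f A + g A) A = rademacher_proj n f A + rademacher_proj n g A"
  by (simp add: rademacher_proj_def rademacher_coeff_add scaleR_add_right sum.distrib)

lemma rademacher_proj_mult:
  "rademacher_proj n (\<lambda>A. c * f A) A = c * rademacher_proj n f A"
  by (simp add: rademacher_proj_def rademacher_coeff_def sum_distrib_left scaleR_sum_right)

text \<open>
  Orthogonality: for \<open>i \<noteq> j\<close>, flipping the \<open>i\<close>-th coordinate changes the sign of every summand.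
\<close>
lemma sum_Pow_rademacher_mult:
  assumes "i < n" "j < n"
  shows "(\<Sum>A\<in>Pow {..<n}. rademacher i A * rademacher j A) = (if i = j then 2 ^ n else 0)"
proof (cases "i = j")
  case True
  have "rademacher j A * rademacher j A = 1" for A by (simp add: rademacher_def)
  then show ?thesis using True by (simp add: card_Pow)
next
  case False
  define flip where "flip A = (if i \<in> A then A - {i} else insert i A)" for A :: "nat set"
  have "(\<Sum>A\<in>Pow {..<n}. rademacher i A * rademacher j A) =
     (\<Sum>A\<in>Pow {..<n}. - (rademacher i A * rademacher j A))"
    using assms False
    by (intro sum.reindex_bij_witness[of _ flip flip]) (auto simp: flip_def rademacher_def)
  then show ?thesis using False by (simp add: sum_negf)
qed

lemma rademacher_proj_rademacher:
  assumes "j < n"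
  shows "rademacher_proj n (\<lambda>A. of_real (rademacher j A) :: 'k::real_normed_field) B = of_real (rademacher j B)"
proof -
  have "rademacher_coeff n (\<lambda>A. of_real (rademacher j A) :: 'k) i = (if i = j then 1 else 0)" if "i < n" for i
  proof -
    have "(\<Sum>A\<in>Pow {..<n}. rademacher i A *\<^sub>R (of_real (rademacher j A) :: 'k)) =
        of_real (\<Sum>A\<in>Pow {..<n}. rademacher i A * rademacher j A)"
      by (simp add: scaleR_conv_of_real)
    also have "\<dots> = (if i = j then 2 ^ n else 0)"
      using that assms by (simp only: sum_Pow_rademacher_mult) auto
    finally show ?thesis by (simp add: rademacher_coeff_def scaleR_conv_of_real)
  qed
  then have "rademacher_proj n (\<lambda>A. of_real (rademacher j A) :: 'k) B =
     (\<Sum>i<n. if i = j then of_real (rademacher j B) else 0)"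
    unfolding rademacher_proj_def by (intro sum.cong) (auto simp: scaleR_conv_of_real)
  then show ?thesis using assms by simp
qed

section \<open>The spaces of p-summable sequences\<close>

lemma ell_finite_support:
  assumes "finite F" "\<And>m. m \<notin> F \<Longrightarrow> x m = 0"
  shows "x \<in> ell p" and "ell_norm p x = (\<Sum>m\<in>F. norm (x m) powr p) powr (1 / p)"
proof -
  have z: "norm (x m) powr p = 0" if "m \<notin> F" for m using assms that by simp
  show "x \<in> ell p" unfolding ell_def using summable_finite[OF assms(1) z] by simp
  show "ell_norm p x = (\<Sum>m\<in>F. norm (x m) powr p) powr (1 / p)"
    unfolding ell_norm_def using suminf_finite[OF assms(1) z] by simp
qed

lemma ell_add:
  assumes "x \<in> ell p" "y \<in> ell p" "p \<ge> 0"
  shows "x + y \<in> ell p"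
proof -
  have "norm ((x + y) m) powr p \<le> 2 powr p * (norm (x m) powr p + norm (y m) powr p)" for m
  proof -
    have "norm ((x + y) m) powr p \<le> (norm (x m) + norm (y m)) powr p"
      using assms(3) norm_triangle_ineq[of "x m" "y m"] by (intro powr_mono2) auto
    also have "\<dots> \<le> 2 powr p * (norm (x m) powr p + norm (y m) powr p)"
      using assms(3) by (intro add_powr_le) auto
    finally show ?thesis .
  qed
  then have bound: "norm (norm ((x + y) m) powr p) \<le> 2 powr p * (norm (x m) powr p + norm (y m) powr p)" for m
    by simp
  have "summable (\<lambda>m. 2 powr p * (norm (x m) powr p + norm (y m) powr p))"
    using assms by (intro summable_mult summable_add) (auto simp: ell_def)
  then show ?thesis
    unfolding ell_def mem_Collect_eq by (rule summable_comparison_test'[OF _ bound])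
qed

lemma ell_seq_scale:
  assumes "x \<in> ell p" "p > 0"
  shows "seq_scale c x \<in> ell p" and "ell_norm p (seq_scale c x) = norm c * ell_norm p x"
proof -
  have eq: "norm (seq_scale c x m) powr p = norm c powr p * norm (x m) powr p" for m
    by (simp add: seq_scale_def norm_mult powr_mult)
  have s: "summable (\<lambda>m. norm (x m) powr p)" using assms by (simp add: ell_def)
  show "seq_scale c x \<in> ell p"
    unfolding ell_def mem_Collect_eq eq by (rule summable_mult[OF s])
  have "(\<Sum>m. norm (seq_scale c x m) powr p) = norm c powr p * (\<Sum>m. norm (x m) powr p)"
    unfolding eq by (rule suminf_mult[OF s])
  moreover have "(\<Sum>m. norm (x m) powr p) \<ge> 0" by (rule suminf_nonneg[OF s]) simp
  ultimately show "ell_norm p (seq_scale c x) = norm c * ell_norm p x"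
    using assms(2) by (simp add: ell_norm_def powr_mult powr_powr)
qed

text \<open>
  Hoelder's inequality against the constant function \<open>1\<close>; after normalization, the \<open>L\<^sub>p\<close> norm is at
  most the \<open>L\<^sub>q\<close> norm on a finite probability space.
\<close>
lemma ell_norm_le_of_supported:
  fixes x :: "nat \<Rightarrow> 'k::real_normed_field"
  assumes p: "p > 0" and pq: "p < q" and supp: "\<And>m. m \<notin> F \<Longrightarrow> x m = 0" and F: "finite F"
  shows "ell_norm p x \<le> real (card F) powr (1 / p - 1 / q) * ell_norm q x"
proof -
  define X where "X s = (\<Sum>m\<in>F. norm (x m) powr s)" for s
  have X: "X s \<ge> 0" for s unfolding X_def by (intro sum_nonneg) auto
  have "X p = (\<Sum>m\<in>F. norm (x m) powr p * 1)" by (simp add: X_def)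
  also have "\<dots> \<le> (\<Sum>m\<in>F. (norm (x m) powr p) powr (q / p)) powr (1 / (q / p)) *
      (\<Sum>m\<in>F. 1 powr (q / (q - p))) powr (1 / (q / (q - p)))"
    using p pq by (intro Holder_inequality_sum F) (auto simp: field_simps)
  also have "\<dots> = X q powr (p / q) * real (card F) powr ((q - p) / q)"
    using p pq by (simp add: powr_powr X_def)
  finally have "X p powr (1 / p) \<le> (X q powr (p / q) * real (card F) powr ((q - p) / q)) powr (1 / p)"
    using p X by (intro powr_mono2) auto
  also have "\<dots> = X q powr (1 / q) * real (card F) powr ((q - p) / q * (1 / p))"
    using p pq by (simp add: powr_mult powr_powr)
  also have "(q - p) / q * (1 / p) = 1 / p - 1 / q" using p pq by (simp add: field_simps)
  finally show ?thesis
    using ell_finite_support(2)[OF F supp] by (simp add: X_def mult.commute)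
qed

section \<open>The block diagonal operator\<close>

text \<open>
  The disjoint union of the cubes is placed in \<open>\<nat>\<close> by two pairing bijections. The indices that
  code a pair \<open>(n, A)\<close> with \<open>A\<close> not contained in \<open>{..<n}\<close> belong to no cube.
\<close>
definition cube_point :: "nat \<Rightarrow> nat set \<Rightarrow> nat" where
  "cube_point n A = prod_encode (n, set_encode A)"

definition cube_points :: "nat \<Rightarrow> nat set" where
  "cube_points n = cube_point n ` Pow {..<n}"

text \<open>
  With counting measure in place of the normalized measure, norms on the \<open>n\<close>-th cube grow by
  \<open>(2 ^ n) powr (1 / p)\<close> in \<open>\<ell>\<^sub>p\<close> and by \<open>(2 ^ n) powr (1 / q)\<close> in \<open>\<ell>\<^sub>q\<close>; the scalar in front of the
  projection compensates for the difference.
\<close>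
definition block_op :: "real \<Rightarrow> real \<Rightarrow> (nat \<Rightarrow> 'k::real_normed_field) \<Rightarrow> nat \<Rightarrow> 'k" where
  "block_op p q x m = (case prod_decode m of (n, k) \<Rightarrow>
     if set_decode k \<subseteq> {..<n}
     then ((2 ^ n) powr (1 / p - 1 / q)) *\<^sub>R rademacher_proj n (\<lambda>A. x (cube_point n A)) (set_decode k)
     else 0)"

lemma finite_subset_lessThan: "A \<subseteq> {..<n::nat} \<Longrightarrow> finite A"
  by (rule finite_subset) auto

lemma inj_on_cube_point: "inj_on (\<lambda>(n, A). cube_point n A) (SIGMA n:UNIV. Pow {..<n})"
  by (auto simp: inj_on_def cube_point_def set_encode_eq finite_subset_lessThan)

lemma inj_on_cube_point_Pow: "inj_on (cube_point n) (Pow {..<n})"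
  by (auto simp: inj_on_def cube_point_def set_encode_eq finite_subset_lessThan)

lemma finite_cube_points: "finite (cube_points n)"
  by (simp add: cube_points_def)

lemma block_op_cube_point:
  assumes "A \<subseteq> {..<n}"
  shows "block_op p q x (cube_point n A) =
    ((2 ^ n) powr (1 / p - 1 / q)) *\<^sub>R rademacher_proj n (\<lambda>B. x (cube_point n B)) A"
  using assms finite_subset_lessThan[OF assms] by (simp add: block_op_def cube_point_def)

lemma block_op_outside:
  assumes "\<And>n. m \<notin> cube_points n"
  shows "block_op p q x m = 0"
proof -
  obtain n k where nk: "prod_decode m = (n, k)" by fastforce
  have m: "m = cube_point n (set_decode k)"
    unfolding cube_point_def by (metis nk prod_decode_inverse set_decode_inverse)
  have "\<not> set_decode k \<subseteq> {..<n}" using assms[of n] m by (auto simp: cube_points_def)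
  then show ?thesis by (simp add: block_op_def nk)
qed

lemma block_op_add: "block_op p q (x + y) = block_op p q x + block_op p q y"
proof
  fix m
  show "block_op p q (x + y) m = (block_op p q x + block_op p q y) m"
    by (cases "prod_decode m") (simp add: block_op_def rademacher_proj_add scaleR_add_right)
qed

lemma block_op_scale: "block_op p q (seq_scale c x) = seq_scale c (block_op p q x)"
proof
  fix m
  show "block_op p q (seq_scale c x) m = seq_scale c (block_op p q x) m"
    by (cases "prod_decode m") (simp add: block_op_def seq_scale_def rademacher_proj_mult)
qed

lemma block_bound:
  fixes x :: "nat \<Rightarrow> 'k::real_normed_field"
  assumes p: "p > 0" and q: "q > 0" and C: "rademacher_proj_bound TYPE('k) p q C"
  shows "(\<Sum>A\<in>Pow {..<n}. norm (block_op p q x (cube_point n A)) powr q) \<le>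
     C * (\<Sum>A\<in>Pow {..<n}. norm (x (cube_point n A)) powr p) powr (q / p)"
proof -
  define N :: real where "N = 2 ^ n"
  define F where "F = (\<Sum>A\<in>Pow {..<n}. norm (x (cube_point n A)) powr p)"
  have N: "N > 0" by (simp add: N_def)
  have F: "F \<ge> 0" unfolding F_def by (auto intro: sum_nonneg)
  have e: "(1 / p - 1 / q) * q = q / p - 1" using q p by (simp add: field_simps)
  have "(\<Sum>A\<in>Pow {..<n}. norm (block_op p q x (cube_point n A)) powr q) =
     N powr (q / p - 1) * (\<Sum>A\<in>Pow {..<n}. norm (rademacher_proj n (\<lambda>A. x (cube_point n A)) A) powr q)"
    unfolding sum_distrib_left using N
    by (intro sum.cong refl) (simp add: block_op_cube_point powr_mult powr_powr e flip: N_def)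
  also have "\<dots> \<le> N powr (q / p - 1) * (C * N * (F / N) powr (q / p))"
    using C unfolding rademacher_proj_bound_def F_def N_def by (intro mult_left_mono) auto
  also have "\<dots> = C * F powr (q / p)"
    using N F by (simp add: powr_divide powr_diff)
  finally show ?thesis by (simp add: F_def)
qed

text \<open>
  The blocks are disjoint, so the bounds for them add up, and \<open>q / p \<ge> 1\<close> allows the power to be
  moved outside the sum over the blocks.
\<close>
lemma sum_block_op_bound:
  fixes x :: "nat \<Rightarrow> 'k::real_normed_field"
  assumes p: "p > 0" and pq: "p \<le> q" and C: "C \<ge> 0" "rademacher_proj_bound TYPE('k) p q C"
    and x: "x \<in> ell p"
  shows "(\<Sum>m<M. norm (block_op p q x m) powr q) \<le> C * (\<Sum>m. norm (x m) powr p) powr (q / p)"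
proof -
  define I where "I = (SIGMA n:{..<M}. Pow {..<n::nat})"
  define pt where "pt = (\<lambda>(n, A). cube_point n A)"
  have I: "finite I" unfolding I_def by auto
  have inj: "inj_on pt I"
    unfolding pt_def by (rule inj_on_subset[OF inj_on_cube_point]) (auto simp: I_def)
  have sumI: "(\<Sum>m\<in>pt ` I. h m) = (\<Sum>n<M. \<Sum>A\<in>Pow {..<n}. h (cube_point n A))" for h :: "nat \<Rightarrow> real"
    unfolding sum.reindex[OF inj] by (simp add: I_def pt_def sum.Sigma split_def)
  have outside: "block_op p q x m = 0" if "m \<in> {..<M} - pt ` I" for m
  proof (rule block_op_outside)
    fix n
    show "m \<notin> cube_points n"
    proof
      assume "m \<in> cube_points n"
      then obtain A where A: "A \<subseteq> {..<n}" "m = cube_point n A" by (auto simp: cube_points_def)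
      \<comment> \<open>Pairing is monotone, so the indices below \<open>M\<close> meet only the first \<open>M\<close> cubes.\<close>
      then have "n \<le> m" by (simp add: cube_point_def le_prod_encode_1)
      with that A show False by (force simp: I_def pt_def)
    qed
  qed
  have "(\<Sum>m<M. norm (block_op p q x m) powr q) \<le> (\<Sum>m\<in>pt ` I. norm (block_op p q x m) powr q)"
  proof -
    have "(\<Sum>m<M. norm (block_op p q x m) powr q) = (\<Sum>m\<in>{..<M} \<inter> pt ` I. norm (block_op p q x m) powr q)"
      by (rule sum.mono_neutral_right) (auto simp: outside)
    also have "\<dots> \<le> (\<Sum>m\<in>pt ` I. norm (block_op p q x m) powr q)"
      by (rule sum_mono2) (use I in auto)
    finally show ?thesis .
  qed
  also have "\<dots> \<le> (\<Sum>n<M. C * (\<Sum>A\<in>Pow {..<n}. norm (x (cube_point n A)) powr p) powr (q / p))"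
    unfolding sumI using p pq C by (intro sum_mono block_bound) auto
  also have "\<dots> \<le> C * (\<Sum>n<M. \<Sum>A\<in>Pow {..<n}. norm (x (cube_point n A)) powr p) powr (q / p)"
    unfolding sum_distrib_left[symmetric] using p pq C
    by (intro mult_left_mono sum_powr_le_powr_sum) (auto intro: sum_nonneg)
  also have "(\<Sum>n<M. \<Sum>A\<in>Pow {..<n}. norm (x (cube_point n A)) powr p) = (\<Sum>m\<in>pt ` I. norm (x m) powr p)"
    by (rule sumI[symmetric])
  also have "C * (\<Sum>m\<in>pt ` I. norm (x m) powr p) powr (q / p) \<le> C * (\<Sum>m. norm (x m) powr p) powr (q / p)"
    using x I p pq C
    by (intro mult_left_mono powr_mono2 sum_le_suminf) (auto simp: ell_def intro: sum_nonneg)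
  finally show ?thesis .
qed

lemma block_op_bounded:
  fixes x :: "nat \<Rightarrow> 'k::real_normed_field"
  assumes p: "p > 0" and pq: "p \<le> q" and C: "C \<ge> 0" "rademacher_proj_bound TYPE('k) p q C"
    and x: "x \<in> ell p"
  shows "block_op p q x \<in> ell q" and "ell_norm q (block_op p q x) \<le> C powr (1 / q) * ell_norm p x"
proof -
  define S where "S = (\<Sum>m. norm (x m) powr p)"
  have S: "S \<ge> 0" unfolding S_def using x by (intro suminf_nonneg) (auto simp: ell_def)
  note bd = sum_block_op_bound[OF assms, folded S_def]
  have s: "summable (\<lambda>m. norm (block_op p q x m) powr q)"
    by (rule summableI_nonneg_bounded[OF _ bd]) auto
  then show "block_op p q x \<in> ell q" by (simp add: ell_def)
  have "ell_norm q (block_op p q x) \<le> (C * S powr (q / p)) powr (1 / q)"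
    unfolding ell_norm_def using p pq
    by (intro powr_mono2 suminf_le_const[OF s bd] suminf_nonneg[OF s]) auto
  also have "\<dots> = C powr (1 / q) * ell_norm p x"
    using C S p pq by (simp add: powr_mult powr_powr ell_norm_def S_def)
  finally show "ell_norm q (block_op p q x) \<le> C powr (1 / q) * ell_norm p x" .
qed

lemma restrict_block_op_in_ell_ops:
  assumes p: "p > 0" and pq: "p \<le> q" and C: "C \<ge> 0" "rademacher_proj_bound TYPE('k::real_normed_field) p q C"
  shows "restrict (block_op p q) (ell p :: (nat \<Rightarrow> 'k) set) \<in> ell_ops p q"
  unfolding ell_ops_def mem_Collect_eq
proof (intro conjI ballI allI)
  show "restrict (block_op p q) (ell p :: (nat \<Rightarrow> 'k) set) \<in> ell p \<rightarrow>\<^sub>E ell q"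
    by (rule restrict_PiE_iff[THEN iffD2]) (blast intro: block_op_bounded(1)[OF assms])
  show "\<exists>K. \<forall>x\<in>ell p. ell_norm q (restrict (block_op p q) (ell p :: (nat \<Rightarrow> 'k) set) x) \<le> K * ell_norm p x"
    using block_op_bounded(2)[OF assms] by (intro exI[of _ "C powr (1 / q)"]) simp
  let ?S = "restrict (block_op p q) (ell p :: (nat \<Rightarrow> 'k) set)"
  show "?S (x + y) = ?S x + ?S y" if "x \<in> ell p" "y \<in> ell p" for x y
    unfolding restrict_apply'[OF that(1)] restrict_apply'[OF that(2)]
      restrict_apply'[OF ell_add[OF that less_imp_le[OF p]]] by (rule block_op_add)
  show "?S (seq_scale c x) = seq_scale c (?S x)" if "x \<in> ell p" for c x
    unfolding restrict_apply'[OF that] restrict_apply'[OF ell_seq_scale(1)[OF that p]]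
    by (rule block_op_scale)
qed

section \<open>The subspaces spanned by Rademacher functions\<close>

text \<open>
  The \<open>i\<close>-th Rademacher function on the \<open>n\<close>-th cube, extended by zero.
\<close>
definition rademacher_seq :: "nat \<Rightarrow> nat \<Rightarrow> nat \<Rightarrow> 'k::real_normed_field" where
  "rademacher_seq n i m = (case prod_decode m of (n', k) \<Rightarrow>
     if n' = n \<and> set_decode k \<subseteq> {..<n} then of_real (rademacher i (set_decode k)) else 0)"

lemma rademacher_seq_cube_point:
  assumes "A \<subseteq> {..<n}"
  shows "rademacher_seq n i (cube_point n A) = of_real (rademacher i A)"
  using assms finite_subset_lessThan[OF assms] by (simp add: rademacher_seq_def cube_point_def)

lemma rademacher_seq_outside:
  assumes "m \<notin> cube_points n"
  shows "rademacher_seq n i m = 0"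
proof -
  obtain n' k where nk: "prod_decode m = (n', k)" by fastforce
  have m: "m = cube_point n' (set_decode k)"
    unfolding cube_point_def by (metis nk prod_decode_inverse set_decode_inverse)
  show ?thesis
  proof (cases "n' = n \<and> set_decode k \<subseteq> {..<n}")
    case True
    then have "m \<in> cube_points n" unfolding m by (auto simp: cube_points_def)
    with assms show ?thesis by simp
  next
    case False
    then show ?thesis by (auto simp: rademacher_seq_def nk)
  qed
qed

lemma block_op_rademacher_seq:
  assumes "i < n"
  shows "block_op p q (rademacher_seq n i :: nat \<Rightarrow> 'k::real_normed_field) =
    seq_scale (of_real ((2 ^ n) powr (1 / p - 1 / q))) (rademacher_seq n i)"
proof
  fix m
  obtain n' k where nk: "prod_decode m = (n', k)" by fastforce
  define A where "A = set_decode k"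
  have m: "m = cube_point n' A"
    unfolding cube_point_def A_def by (metis nk prod_decode_inverse set_decode_inverse)
  let ?e = "rademacher_seq n i :: nat \<Rightarrow> 'k"
  consider "A \<subseteq> {..<n'}" "n' = n" | "A \<subseteq> {..<n'}" "n' \<noteq> n" | "\<not> A \<subseteq> {..<n'}" by blast
  then show "block_op p q ?e m = seq_scale (of_real ((2 ^ n) powr (1 / p - 1 / q))) ?e m"
  proof cases
    case 1
    have "rademacher_coeff n (\<lambda>B. ?e (cube_point n B)) = rademacher_coeff n (\<lambda>B. of_real (rademacher i B))"
      unfolding rademacher_coeff_def
      by (intro ext arg_cong[where f = "\<lambda>x. x /\<^sub>R 2 ^ n"] sum.cong refl) (simp add: rademacher_seq_cube_point)
    then have "rademacher_proj n (\<lambda>B. ?e (cube_point n B)) A = of_real (rademacher i A)"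
      using rademacher_proj_rademacher[OF assms, of A, where 'k = 'k] by (simp add: rademacher_proj_def)
    with 1 m show ?thesis
      by (simp add: block_op_cube_point rademacher_seq_cube_point seq_scale_def scaleR_conv_of_real)
  next
    case 2
    then have "?e (cube_point n' B) = 0" for B
      by (simp add: rademacher_seq_def cube_point_def)
    with 2 m show ?thesis
      by (simp add: block_op_cube_point seq_scale_def rademacher_proj_def rademacher_coeff_def)
  next
    case 3
    then show ?thesis
      by (auto simp: block_op_def rademacher_seq_def seq_scale_def nk A_def)
  qed
qed

lemma card_cube_points: "card (cube_points n) = 2 ^ n"
  unfolding cube_points_def by (simp add: card_image[OF inj_on_cube_point_Pow] card_Pow)

definition rademacher_space :: "nat \<Rightarrow> (nat \<Rightarrow> 'k::real_normed_field) set" where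
  "rademacher_space n = seq.span (rademacher_seq n ` {..<n})"

lemma rademacher_space_supported:
  assumes "x \<in> rademacher_space n" "m \<notin> cube_points n"
  shows "x m = 0"
proof -
  have "rademacher_space n \<subseteq> {x. x m = 0}"
    unfolding rademacher_space_def using assms(2)
    by (intro seq.span_minimal)
       (auto simp: rademacher_seq_outside seq.subspace_def seq_scale_def)
  then show ?thesis using assms by blast
qed

lemma block_op_rademacher_space:
  assumes "x \<in> rademacher_space n"
  shows "block_op p q x = seq_scale (of_real ((2 ^ n) powr (1 / p - 1 / q))) x"
proof -
  let ?c = "of_real ((2 ^ n) powr (1 / p - 1 / q)) :: 'a"
  have "rademacher_space n \<subseteq> {x. block_op p q x = seq_scale ?c x}"
    unfolding rademacher_space_def
  proof (rule seq.span_minimal)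
    show "seq.subspace {x. block_op p q x = seq_scale ?c x}"
      unfolding seq.subspace_def
    proof (intro conjI ballI allI)
      have "block_op p q (seq_scale 0 0) = seq_scale 0 (block_op p q (0 :: nat \<Rightarrow> 'a))"
        by (rule block_op_scale)
      then show "0 \<in> {x. block_op p q x = seq_scale ?c x}" by simp
    qed (auto simp: block_op_add block_op_scale seq.scale_right_distrib seq.scale_left_commute)
  qed (auto simp: block_op_rademacher_seq)
  then show ?thesis using assms by blast
qed

text \<open>
  On this space the operator is multiplication by \<open>(2 ^ n) powr (1 / p - 1 / q)\<close>, which is exactly
  the constant in the comparison of the two norms on \<open>2 ^ n\<close> points.
\<close>
lemma block_op_lower_bound:
  assumes p: "p > 0" and pq: "p < q" and x: "x \<in> rademacher_space n"
  shows "ell_norm p x \<le> ell_norm q (block_op p q x)"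
proof -
  note supp = rademacher_space_supported[OF x]
  have "ell_norm p x \<le> (2 ^ n) powr (1 / p - 1 / q) * ell_norm q x"
    using ell_norm_le_of_supported[OF p pq supp finite_cube_points] by (simp add: card_cube_points)
  also have "\<dots> = ell_norm q (block_op p q x)"
    using p pq unfolding block_op_rademacher_space[OF x]
    by (simp add: ell_seq_scale(2)[OF ell_finite_support(1)[OF finite_cube_points supp]])
  finally show ?thesis .
qed

lemma rademacher_space_subset_ell: "rademacher_space n \<subseteq> ell p"
proof
  fix x :: "nat \<Rightarrow> 'a" assume "x \<in> rademacher_space n"
  then show "x \<in> ell p"
    using ell_finite_support(1)[OF finite_cube_points] rademacher_space_supported by blast
qed

text \<open>
  At the points \<open>{j}\<close> and \<open>{}\<close> of the cube all Rademacher functions except the \<open>j\<close>-th agree, so the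
  difference of the two values of the combination is \<open>2 * c j\<close>.
\<close>
lemma rademacher_seq_coeff_zero:
  fixes c :: "nat \<Rightarrow> 'k::real_normed_field"
  assumes sum: "(\<Sum>i<n. seq_scale (c i) (rademacher_seq n i)) = 0" and j: "j < n"
  shows "c j = 0"
proof -
  have fn: "(\<Sum>i\<in>I. g i) m = (\<Sum>i\<in>I. g i m)" for I m and g :: "nat \<Rightarrow> nat \<Rightarrow> 'k"
    by (induction I rule: infinite_finite_induct) auto
  have at: "(\<Sum>i<n. c i * of_real (rademacher i A)) = 0" if "A \<subseteq> {..<n}" for A
    using fun_cong[OF sum, of "cube_point n A"] that
    by (simp add: fn seq_scale_def rademacher_seq_cube_point)
  have "0 = (\<Sum>i<n. c i * of_real (rademacher i {j}) - c i * of_real (rademacher i {}))"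
    unfolding sum_subtractf using at[of "{j}"] at[of "{}"] j by simp
  also have "\<dots> = (\<Sum>i<n. if i = j then 2 * c j else 0)"
    by (intro sum.cong) (auto simp: rademacher_def)
  finally show ?thesis using j by simp
qed

lemma dim_rademacher_space: "seq.dim (rademacher_space n :: (nat \<Rightarrow> 'k::real_normed_field) set) = n"
proof -
  let ?e = "rademacher_seq n :: nat \<Rightarrow> nat \<Rightarrow> 'k"
  have inj: "inj_on ?e {..<n}"
  proof (rule inj_onI, rule ccontr)
    fix i j assume ij: "i \<in> {..<n}" "j \<in> {..<n}" "?e i = ?e j" "i \<noteq> j"
    have "rademacher i {i} = rademacher j {i}"
      using fun_cong[OF ij(3), of "cube_point n {i}"] ij(1,2) by (simp add: rademacher_seq_cube_point)
    with ij(4) show False by (simp add: rademacher_def)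
  qed
  have "seq.independent (?e ` {..<n})"
  proof (rule seq.independent_if_scalars_zero)
    fix f x assume s: "(\<Sum>x\<in>?e ` {..<n}. seq_scale (f x) x) = 0" and "x \<in> ?e ` {..<n}"
    then obtain j where j: "j < n" "x = ?e j" by auto
    show "f x = 0"
      using rademacher_seq_coeff_zero[of "\<lambda>i. f (?e i)" n j] s j by (simp add: sum.reindex[OF inj])
  qed simp
  from seq.dim_span_eq_card_independent[OF this] show ?thesis
    unfolding rademacher_space_def by (simp only: card_image[OF inj] card_lessThan)
qed

lemma ex_unit_vector_rademacher_space:
  assumes "p > 0" "n > 0"
  shows "\<exists>x\<in>rademacher_space n. ell_norm p (x :: nat \<Rightarrow> 'k::real_normed_field) = 1"
proof -
  let ?e = "rademacher_seq n 0 :: nat \<Rightarrow> 'k"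
  have e: "?e \<in> rademacher_space n"
    unfolding rademacher_space_def using assms by (intro seq.span_base) auto
  have "norm (?e m) powr p = 1" if "m \<in> cube_points n" for m
    using that by (auto simp: cube_points_def rademacher_seq_cube_point rademacher_def)
  then have nz: "ell_norm p ?e > 0"
    by (simp add: ell_finite_support(2)[OF finite_cube_points rademacher_space_supported[OF e]] card_cube_points)
  define x where "x = seq_scale (of_real (1 / ell_norm p ?e)) ?e"
  have "x \<in> rademacher_space n"
    using e unfolding x_def rademacher_space_def by (rule seq.span_scale)
  moreover have "ell_norm p x = 1"
  proof -
    have "?e \<in> ell p" using e rademacher_space_subset_ell by blast
    then have "ell_norm p x = norm (of_real (1 / ell_norm p ?e) :: 'k) * ell_norm p ?e"
      unfolding x_def using assms by (intro ell_seq_scale(2)) auto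
    then show ?thesis using nz by (simp only: norm_of_real) simp
  qed
  ultimately show ?thesis by blast
qed

section \<open>Failure of finite strict singularity\<close>

lemma not_finitely_strictly_singular_block_op:
  assumes p: "p > 0" and pq: "p < q"
  shows "\<not> finitely_strictly_singular p q (restrict (block_op p q) (ell p :: (nat \<Rightarrow> 'k::real_normed_field) set))"
proof
  let ?S = "restrict (block_op p q) (ell p :: (nat \<Rightarrow> 'k) set)"
  assume "finitely_strictly_singular p q ?S"
  from this[unfolded finitely_strictly_singular_def, THEN spec[of _ 1], THEN mp, OF zero_less_one]
  obtain n where n: "n > 0" and lt:
    "\<And>E. E \<subseteq> ell p \<Longrightarrow> seq.subspace E \<Longrightarrow> seq.dim E = n \<Longrightarrow>
       (INF x\<in>{x \<in> E. ell_norm p x = 1}. ell_norm q (?S x)) < 1"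
    by blast
  let ?E = "rademacher_space n :: (nat \<Rightarrow> 'k) set"
  have "(INF x\<in>{x \<in> ?E. ell_norm p x = 1}. ell_norm q (?S x)) < 1"
    by (rule lt[OF rademacher_space_subset_ell _ dim_rademacher_space]) (simp add: rademacher_space_def)
  moreover have "1 \<le> (INF x\<in>{x \<in> ?E. ell_norm p x = 1}. ell_norm q (?S x))"
  proof (rule cINF_greatest)
    show "{x \<in> ?E. ell_norm p x = 1} \<noteq> {}" using ex_unit_vector_rademacher_space[OF p n] by blast
  next
    fix x assume "x \<in> {x \<in> ?E. ell_norm p x = 1}"
    then show "1 \<le> ell_norm q (?S x)"
      using block_op_lower_bound[OF p pq, of x n] rademacher_space_subset_ell[of n p] by auto
  qed
  ultimately show False by simp
qed

text \<open>
  The scalar field enters only through the uniform bound for the Rademacher projections.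
\<close>
lemma FSS_ideal_neq_ell_ops:
  assumes "p > 0" "p < q" and "C \<ge> 0" "rademacher_proj_bound TYPE('k::real_normed_field) p q C"
  shows "(FSS_ideal p q :: ((nat \<Rightarrow> 'k) \<Rightarrow> (nat \<Rightarrow> 'k)) set) \<noteq> ell_ops p q"
  using restrict_block_op_in_ell_ops[OF assms(1) less_imp_le[OF assms(2)] assms(3,4)]
    not_finitely_strictly_singular_block_op[OF assms(1,2), where 'k = 'k]
  unfolding FSS_ideal_def by blast

theorem corollary4p3:
  fixes p q :: real
  assumes "1 < p" and "p < q"
  shows "(FSS_ideal p q :: ((nat \<Rightarrow> real) \<Rightarrow> (nat \<Rightarrow> real)) set) \<noteq> ell_ops p q
    \<and> (FSS_ideal p q :: ((nat \<Rightarrow> complex) \<Rightarrow> (nat \<Rightarrow> complex)) set) \<noteq> ell_ops p q"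
proof -
  have p: "p > 0" "q > 0" using assms by auto
  obtain C where C: "C \<ge> 0" "rademacher_proj_bound TYPE(real) p q C"
    using rademacher_proj_bound_real[OF assms(1) p(2)] by blast
  obtain D where D: "D \<ge> 0" "rademacher_proj_bound TYPE(complex) p q D"
    using rademacher_proj_bound_complex[OF assms(1) p(2)] by blast
  show ?thesis
    using FSS_ideal_neq_ell_ops[OF p(1) assms(2) C] FSS_ideal_neq_ell_ops[OF p(1) assms(2) D] by blast
qed

end
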